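(* Let $\alpha,\delta\in(0,1)$ be fixed and consider any sequence of models $(\mathbf P^{(m)})_{m\ge1}$ in the top-$k$ setting. Let $\hat k_\alpha$ be the number of nulls rejected by the Benjamini–Hochberg (BH) procedure at level $\alpha$. Put $\kappa=\pi^2/6$ and $$\overline{\mathrm{FDP}}^{\mathrm{DKW}}_\alpha=\mathbf 1\{\hat k_\alpha\ge1\}\wedge\left(\alpha+\frac{m^{1/2}\sqrt{0.5\log(1/\delta)}}{1\vee\hat k_\alpha}\right),$$ $$\overline{\mathrm{FDP}}^{\mathrm{Well}}_\alpha=\mathbf 1\{\hat k_\alpha\ge1\}\wedge\left(\alpha\,h^{-1}\!\left(\frac{2\log(\kappa/\delta)+4\log\Bigl(1+\log_2\bigl(\tfrac{m}{\alpha(1\vee\hat k_\alpha)}\bigr)\Bigr)}{\alpha(1\vee\hat k_\alpha)}\right)\right).$$ Then, as $m\to\infty$: - $\overline{\mathrm{FDP}}^{\mathrm{DKW}}_\alpha$ is BH $m$-consistent if $m^{1/2}/\hat k_\alpha=o_P(1)$; - $\overline{\mathrm{FDP}}^{\mathrm{Well}}_\alpha$ is BH $m$-consistent if $(\log\log m)/\hat k_\alpha=o_P(1)$. Here a bound $\overline{\mathrm{FDP}}_\alpha$ is BH $m$-consistent if for all $\epsilon>0$, $\lim_{m\to\infty}\mathbf P^{(m)}\bigl(\overline{\mathrm{FDP}}_\alpha-\alpha\ge\epsilon\bigr)=0$.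
   Context: Top-$k$ setting, for each $m$: under $\mathbf P^{(m)}$, $p_1,\dots,p_m\in[0,1]$ are independent, with a fixed set of true nulls $\mathcal H_0\subset\{1,\dots,m\}$ such that $p_i\sim U(0,1)$ for $i\in\mathcal H_0$. With ordered $p$-values $p_{(1)}\le\dots\le p_{(m)}$, $\hat k_\alpha=\max\{k\in\{1,\dots,m\}: mp_{(k)}/k\le\alpha\}$ ($=0$ if the set is empty). $o_P(1)$ denotes convergence to $0$ in probability under $\mathbf P^{(m)}$ as $m\to\infty$ (with $1/0=+\infty$). The function $h(\lambda)=\lambda(\log\lambda-1)+1$, $\lambda>1$, is an increasing bijection from $(1,\infty)$ onto $(0,\infty)$ with inverse $h^{-1}$. *)

theory Defs
  imports "HOL-Probability.Probability"
begin

locale topk_model = prob_space M for M :: "'a measure" +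
  fixes m :: nat and p :: "nat \<Rightarrow> 'a \<Rightarrow> real" and H0 :: "nat set"
  assumes p_unit_interval: "\<And>i \<omega>. i \<in> {1..m} \<Longrightarrow> \<omega> \<in> space M \<Longrightarrow> p i \<omega> \<in> {0..1}"
    and p_indep: "indep_vars (\<lambda>_. borel) p {1..m}"
    and nulls_subset: "H0 \<subseteq> {1..m}"
    and nulls_uniform: "\<And>i. i \<in> H0 \<Longrightarrow> distr M borel (p i) = uniform_measure lborel {0..1}"

definition order_stat :: "nat \<Rightarrow> (nat \<Rightarrow> real) \<Rightarrow> nat \<Rightarrow> real" where
  "order_stat m q k = sort (map q [1..<Suc m]) ! (k - 1)"

definition khat :: "real \<Rightarrow> nat \<Rightarrow> (nat \<Rightarrow> real) \<Rightarrow> nat" where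
  "khat \<alpha> m q =
    (let S = {k \<in> {1..m}. real m * order_stat m q k / real k \<le> \<alpha>}
     in if S = {} then 0 else Max S)"

definition h :: "real \<Rightarrow> real" where
  "h l = l * (ln l - 1) + 1"

definition h_inv :: "real \<Rightarrow> real" where
  "h_inv = the_inv_into {1<..} h"

lemma h_bij_betw: "bij_betw h {1<..} {0<..}"
proof -
  have deriv: "(h has_real_derivative ln x) (at x)" if "x > 0" for x
    unfolding h_def using that by (auto intro!: derivative_eq_intros)
  have cont: "continuous_on {a..b} h" if "a > 0" for a b
    using deriv that by (intro DERIV_continuous_on[where D = ln])
      (auto intro: has_field_derivative_at_within)
  have less: "h x < h y" if "1 \<le> x" "x < y" for x y
  proof (rule DERIV_pos_imp_increasing_open[OF that(2)])
    show "\<exists>d. DERIV h z :> d \<and> 0 < d" if "x < z" "z < y" for z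
      using deriv[of z] that \<open>1 \<le> x\<close> by (intro exI[of _ "ln z"]) auto
    show "continuous_on {x..y} h" using cont that by auto
  qed
  have inj: "inj_on h {1<..}"
  proof (rule linorder_inj_onI)
    show "h x \<noteq> h y" if "x < y" "x \<in> {1<..}" for x y
      using less[of x y] that by simp
  qed auto
  have h1: "h 1 = 0" by (simp add: h_def)
  have "h ` {1<..} = {0<..}"
  proof (intro equalityI subsetI)
    fix y assume "y \<in> h ` {1<..}"
    then show "y \<in> {0<..}" using less[of 1] h1 by auto
  next
    fix y :: real assume y: "y \<in> {0<..}"
    define b where "b = exp (1 + y)"
    have b: "b > 1" using y by (simp add: b_def)
    have "1 * y \<le> b * y" using y b by (intro mult_right_mono) auto
    moreover have "h b = b * y + 1" by (simp add: h_def b_def)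
    ultimately have "y \<le> h b" by simp
    with y h1 b obtain x where x: "1 \<le> x" "x \<le> b" "h x = y"
      using IVT'[of h 1 y b] cont[of 1 b] by auto
    with y h1 have "x \<noteq> 1" by auto
    with x show "y \<in> h ` {1<..}" by (intro image_eqI[of _ _ x]) auto
  qed
  with inj show ?thesis by (simp add: bij_betw_def)
qed

definition FDP_DKW :: "real \<Rightarrow> real \<Rightarrow> nat \<Rightarrow> (nat \<Rightarrow> real) \<Rightarrow> real" where
  "FDP_DKW \<alpha> \<delta> m q =
    (let k = khat \<alpha> m q in
     min (of_bool (k \<ge> 1))
         (\<alpha> + sqrt (real m) * sqrt (0.5 * ln (1 / \<delta>)) / real (max 1 k)))"

definition FDP_Well :: "real \<Rightarrow> real \<Rightarrow> nat \<Rightarrow> (nat \<Rightarrow> real) \<Rightarrow> real" where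
  "FDP_Well \<alpha> \<delta> m q =
    (let k = khat \<alpha> m q; \<kappa> = pi\<^sup>2 / 6 in
     min (of_bool (k \<ge> 1))
         (\<alpha> * h_inv ((2 * ln (\<kappa> / \<delta>) + 4 * ln (1 + log 2 (real m / (\<alpha> * real (max 1 k)))))
                     / (\<alpha> * real (max 1 k)))))"

text \<open>Extended real values, so that a positive number divided by \<open>0\<close> is \<open>\<infinity>\<close>.\<close>

definition oP1 :: "(nat \<Rightarrow> 'a measure) \<Rightarrow> (nat \<Rightarrow> 'a \<Rightarrow> ereal) \<Rightarrow> bool" where
  "oP1 M X \<longleftrightarrow>
    (\<forall>\<epsilon>::real. \<epsilon> > 0 \<longrightarrow>
      (\<lambda>m. measure (M m) {\<omega> \<in> space (M m). \<bar>X m \<omega>\<bar> \<ge> ereal \<epsilon>}) \<longlonglongrightarrow> 0)"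

definition BH_m_consistent :: "(nat \<Rightarrow> 'a measure) \<Rightarrow> real \<Rightarrow> (nat \<Rightarrow> 'a \<Rightarrow> real) \<Rightarrow> bool" where
  "BH_m_consistent M \<alpha> B \<longleftrightarrow>
    (\<forall>\<epsilon>::real. \<epsilon> > 0 \<longrightarrow>
      (\<lambda>m. measure (M m) {\<omega> \<in> space (M m). B m \<omega> - \<alpha> \<ge> \<epsilon>}) \<longlonglongrightarrow> 0)"

end

theory Submission
  imports Defs "HOL-Real_Asymp.Real_Asymp"
begin

text \<open>
  Both claims are deterministic: an excess of the bound over \<open>\<alpha>\<close> by \<open>\<epsilon>\<close> forces the ratio in the
  hypothesis to exceed a fixed positive constant. For the Wellner bound, \<open>h\<close> is increasing, so an
  excess forces its argument above \<open>h (1 + \<epsilon> / \<alpha>)\<close>, while the numerator of that argument is at most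
  \<open>5 log log m\<close> for large \<open>m\<close>. Passing from inclusion of events to probabilities needs
  measurability of the larger event only; it holds because \<open>p\<^bsub>(k)\<^esub> \<le> t\<close> says that at least \<open>k\<close> of the
  \<open>p\<close>-values are at most \<open>t\<close>.
\<close>

text \<open>In a sorted list the entries at most \<open>t\<close> form a prefix, and index
  \<open>j\<close> (counted from 0) lies in it exactly when the prefix has length at least
  \<open>Suc j\<close>.\<close>

lemma sorted_nth_le_iff_length_filter:
  fixes xs :: "'a :: linorder list"
  assumes "sorted xs" and "j < length xs"
  shows "xs ! j \<le> t \<longleftrightarrow> Suc j \<le> length (filter (\<lambda>x. x \<le> t) xs)"
  using assms
proof (induction xs arbitrary: j)
  case Nil
  then show ?case by simp
next
  case (Cons x xs)
  show ?case
  proof (cases "x \<le> t")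
    case True
    then show ?thesis using Cons by (cases j) auto
  next
    \<comment> \<open>The head is the least entry, so no entry is at most \<open>t\<close> and both
      sides are false.\<close>
    case False
    then have none: "\<not> y \<le> t" if "y \<in> set (x # xs)" for y
      using Cons.prems(1) that by fastforce
    then have "filter (\<lambda>x. x \<le> t) (x # xs) = []"
      by (simp add: filter_empty_conv)
    then show ?thesis using none nth_mem[OF Cons.prems(2)] by simp
  qed
qed

text \<open>Sorting changes neither the number of entries at most \<open>t\<close> nor their
  multiplicity, so the count can be made over the indices, which are distinct. Since
  \<open>k\<close> is at least 1, the shift to index \<open>k - 1\<close> cancels against
  \<open>Suc\<close>.\<close>

lemma order_stat_le_iff_card:
  assumes "k \<in> {1..m}"
  shows "order_stat m q k \<le> t \<longleftrightarrow> k \<le> card {i \<in> {1..m}. q i \<le> t}"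
proof -
  have "order_stat m q k \<le> t \<longleftrightarrow>
      k \<le> length (filter (\<lambda>x. x \<le> t) (sort (map q [1..<Suc m])))"
    unfolding order_stat_def using assms
    by (subst sorted_nth_le_iff_length_filter) auto
  also have "length (filter (\<lambda>x. x \<le> t) (sort (map q [1..<Suc m])))
      = length (filter (\<lambda>i. q i \<le> t) [1..<Suc m])"
    by (simp only: filter_sort length_sort filter_map length_map comp_def)
  also have "\<dots> = card (set (filter (\<lambda>i. q i \<le> t) [1..<Suc m]))"
    by (rule distinct_card[symmetric]) simp
  also have "set (filter (\<lambda>i. q i \<le> t) [1..<Suc m]) = {i \<in> {1..m}. q i \<le> t}"
    by auto
  finally show ?thesis .
qed

lemma khat_le: "khat \<alpha> m q \<le> m"
  unfolding khat_def Let_def by (auto intro!: Max.boundedI)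

text \<open>\<open>khat\<close> is the maximum of a random set of naturals; it is measurable once
  membership of each fixed \<open>k\<close> is a measurable event.\<close>

lemma measurable_khat:
  assumes meas: "\<And>i. i \<in> {1..m} \<Longrightarrow> p i \<in> borel_measurable M"
  shows "(\<lambda>\<omega>. khat \<alpha> m (\<lambda>i. p i \<omega>)) \<in> measurable M (count_space UNIV)"
proof -
  define P where "P k \<omega> \<longleftrightarrow> k \<in> {1..m} \<and> real m * order_stat m (\<lambda>i. p i \<omega>) k / real k \<le> \<alpha>"
    for k \<omega>
  \<comment> \<open>The order statistic is traded for a finite sum of indicators, whose
    measurability follows from that of each \<open>p i\<close>.\<close>
  have P_iff: "P k \<omega> \<longleftrightarrow> k \<in> {1..m} \<and>
      real k \<le> (\<Sum>i\<in>{1..m}. indicator {..\<alpha> * real k / real m} (p i \<omega>))" for k \<omega>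
  proof (cases "k \<in> {1..m}")
    case True
    then have "P k \<omega> \<longleftrightarrow> order_stat m (\<lambda>i. p i \<omega>) k \<le> \<alpha> * real k / real m"
      by (auto simp: P_def field_simps)
    also have "\<dots> \<longleftrightarrow> k \<le> card {i \<in> {1..m}. p i \<omega> \<le> \<alpha> * real k / real m}"
      by (rule order_stat_le_iff_card[OF True])
    also have "\<dots> \<longleftrightarrow> real k \<le> real (card {i \<in> {1..m}. p i \<omega> \<le> \<alpha> * real k / real m})"
      by simp
    also have "real (card {i \<in> {1..m}. p i \<omega> \<le> \<alpha> * real k / real m})
        = (\<Sum>i\<in>{1..m}. indicator {..\<alpha> * real k / real m} (p i \<omega>))"
      by (simp add: indicator_def sum.If_cases Int_def)
    finally show ?thesis using True by simp
  qed (auto simp: P_def)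
  have [measurable]: "Measurable.pred M (P k)" for k
  proof -
    have "(\<lambda>\<omega>. \<Sum>i\<in>{1..m}. indicator {..\<alpha> * real k / real m} (p i \<omega>) :: real)
        \<in> borel_measurable M"
      using meas by (intro borel_measurable_sum) (simp add: measurable_compose)
    then show ?thesis unfolding P_iff[abs_def] by measurable
  qed
  have "(\<lambda>\<omega>. khat \<alpha> m (\<lambda>i. p i \<omega>)) =
      (\<lambda>\<omega>. if \<exists>k. P k \<omega> then Max {k. P k \<omega>} else 0)"
  proof
    fix \<omega>
    have "{k \<in> {1..m}. real m * order_stat m (\<lambda>i. p i \<omega>) k / real k \<le> \<alpha>} = {k. P k \<omega>}"
      by (simp add: P_def)
    then show "khat \<alpha> m (\<lambda>i. p i \<omega>) = (if \<exists>k. P k \<omega> then Max {k. P k \<omega>} else 0)"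
      by (simp only: khat_def Let_def) simp
  qed
  also have "\<dots> \<in> measurable M (count_space UNIV)"
    by (intro measurable_If measurable_Max_nat pred_intros_countable predE) auto
  finally show ?thesis .
qed

text \<open>\<open>X\<close> sees the \<open>p\<close>-values only through \<open>khat\<close>, so
  its exceedance event is the preimage of a set of naturals under a measurable map. Quantifying over
  all \<open>q\<close> makes \<open>bound\<close> an inclusion of events for each large
  \<open>m\<close>.\<close>

lemma BH_m_consistent_if_oP1_bound:
  fixes X :: "nat \<Rightarrow> nat \<Rightarrow> ereal"
  assumes model: "\<And>m. m \<ge> 1 \<Longrightarrow> topk_model (M m) m (p m) (H0 m)"
    and oP: "oP1 M (\<lambda>m \<omega>. X m (khat \<alpha> m (\<lambda>i. p m i \<omega>)))"
    and bound: "\<And>\<epsilon>. \<epsilon> > 0 \<Longrightarrow> \<exists>\<epsilon>'>0. \<forall>\<^sub>F m in sequentially. \<forall>q.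
      B m q - \<alpha> \<ge> \<epsilon> \<longrightarrow> \<bar>X m (khat \<alpha> m q)\<bar> \<ge> ereal \<epsilon>'"
  shows "BH_m_consistent M \<alpha> (\<lambda>m \<omega>. B m (\<lambda>i. p m i \<omega>))"
  unfolding BH_m_consistent_def
proof (intro allI impI)
  fix \<epsilon> :: real assume "\<epsilon> > 0"
  from bound[OF this] obtain \<epsilon>' where \<epsilon>': "\<epsilon>' > 0"
    and ev: "\<forall>\<^sub>F m in sequentially. \<forall>q. B m q - \<alpha> \<ge> \<epsilon> \<longrightarrow> \<bar>X m (khat \<alpha> m q)\<bar> \<ge> ereal \<epsilon>'"
    by blast
  let ?A = "\<lambda>m. {\<omega> \<in> space (M m). B m (\<lambda>i. p m i \<omega>) - \<alpha> \<ge> \<epsilon>}"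
  let ?E = "\<lambda>m. {\<omega> \<in> space (M m). \<bar>X m (khat \<alpha> m (\<lambda>i. p m i \<omega>))\<bar> \<ge> ereal \<epsilon>'}"
  have lim: "(\<lambda>m. measure (M m) (?E m)) \<longlonglongrightarrow> 0"
    using oP \<epsilon>' unfolding oP1_def by blast
  have le: "\<forall>\<^sub>F m in sequentially. measure (M m) (?A m) \<le> measure (M m) (?E m)"
    using ev eventually_ge_at_top[of 1]
  proof eventually_elim
    case (elim m)
    interpret topk_model "M m" m "p m" "H0 m" using model elim by simp
    \<comment> \<open>Measurability of each \<open>p\<close>-value is part of the definition of
      \<open>indep_vars\<close>.\<close>
    have "p m i \<in> borel_measurable (M m)" if "i \<in> {1..m}" for i
      using p_indep that unfolding indep_vars_def by simp
    then have "(\<lambda>\<omega>. khat \<alpha> m (\<lambda>i. p m i \<omega>)) \<in> measurable (M m) (count_space UNIV)"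
      by (rule measurable_khat)
    from measurable_sets[OF this, of "{k. \<bar>X m k\<bar> \<ge> ereal \<epsilon>'}"]
    have "?E m \<in> events" by (simp add: vimage_def Int_def conj_commute)
    moreover have "?A m \<subseteq> ?E m" using elim by auto
    ultimately show ?case by (intro finite_measure_mono)
  qed
  show "(\<lambda>m. measure (M m) (?A m)) \<longlonglongrightarrow> 0"
    by (rule tendsto_sandwich[OF _ le tendsto_const lim]) simp
qed

text \<open>The derivative of \<open>h\<close> at \<open>z\<close> is \<open>ln z\<close>, which is
  nonnegative from 1 on.\<close>

lemma h_mono: "h x \<le> h y" if "1 \<le> x" "x \<le> y"
proof (rule DERIV_nonneg_imp_nondecreasing[OF that(2)])
  fix z assume "x \<le> z" "z \<le> y"
  then show "\<exists>d. DERIV h z :> d \<and> 0 \<le> d"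
    using that unfolding h_def
    by (intro exI[of _ "ln z"]) (auto intro!: derivative_eq_intros)
qed

text \<open>Positivity of \<open>a\<close> puts it in the range of \<open>h\<close> on
  \<open>{1<..}\<close>, where \<open>h_inv\<close> is a right inverse of \<open>h\<close>; the rest
  is monotonicity.\<close>

lemma h_le_if_le_h_inv:
  assumes "0 < a" "1 \<le> x" "x \<le> h_inv a"
  shows "h x \<le> a"
proof -
  have "h (h_inv a) = a"
    unfolding h_inv_def using h_bij_betw assms(1)
    by (intro f_the_inv_into_f) (auto simp: bij_betw_def)
  then show ?thesis using h_mono[OF assms(2,3)] by simp
qed

lemma FDP_DKW_excess_imp:
  assumes "0 \<le> \<alpha>" "0 < \<delta>" "\<delta> < 1" "\<epsilon> > 0" "FDP_DKW \<alpha> \<delta> m q - \<alpha> \<ge> \<epsilon>"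
  shows "khat \<alpha> m q \<ge> 1"
    and "sqrt (real m) / real (khat \<alpha> m q) \<ge> \<epsilon> / sqrt (0.5 * ln (1 / \<delta>))"
proof -
  show k: "khat \<alpha> m q \<ge> 1"
    \<comment> \<open>With no rejection the indicator caps the bound at 0, so it cannot exceed
      \<alpha> by a positive amount.\<close>
    using assms by (cases "khat \<alpha> m q = 0") (auto simp: FDP_DKW_def Let_def)
  have "\<epsilon> \<le> sqrt (real m) * sqrt (0.5 * ln (1 / \<delta>)) / real (khat \<alpha> m q)"
    using assms k by (simp add: FDP_DKW_def Let_def max_def split: if_splits)
  moreover have "sqrt (0.5 * ln (1 / \<delta>)) > 0" using assms by simp
  ultimately show "sqrt (real m) / real (khat \<alpha> m q) \<ge> \<epsilon> / sqrt (0.5 * ln (1 / \<delta>))"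
    by (simp add: field_simps)
qed

lemma pi_squared_div_6_gt_1: "pi\<^sup>2 / 6 > 1"
proof -
  have "3 < pi" using pi_approx by simp
  then have "3 * 3 < pi * pi" by (intro mult_strict_mono) auto
  then show ?thesis by (simp add: power2_eq_square)
qed

text \<open>Replacing \<open>m / (\<alpha> * k)\<close> by \<open>m / \<alpha>\<close> inside the
  logarithm only enlarges the numerator and leaves \<open>khat\<close> in the denominator alone, as
  in the hypothesis on the ratio.\<close>

lemma FDP_Well_excess_imp:
  assumes \<alpha>: "0 < \<alpha>" "\<alpha> < 1" and \<delta>: "0 < \<delta>" "\<delta> < 1" and \<epsilon>: "\<epsilon> > 0"
    and ge: "FDP_Well \<alpha> \<delta> m q - \<alpha> \<ge> \<epsilon>"
  shows "khat \<alpha> m q \<ge> 1"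
    and "\<alpha> * h (1 + \<epsilon> / \<alpha>) \<le>
      (2 * ln (pi\<^sup>2 / 6 / \<delta>) + 4 * ln (1 + log 2 (real m / \<alpha>))) / real (khat \<alpha> m q)"
proof -
  define k where "k = khat \<alpha> m q"
  have k: "k \<ge> 1"
    unfolding k_def using assms by (cases "khat \<alpha> m q = 0") (auto simp: FDP_Well_def Let_def)
  then show "khat \<alpha> m q \<ge> 1" by (simp add: k_def)
  define L where "L x = 2 * ln (pi\<^sup>2 / 6 / \<delta>) + 4 * ln (1 + log 2 x)" for x
  have km: "k \<le> m" by (simp add: k_def khat_le)
  have "\<alpha> * real k \<le> 1 * real k" using \<alpha> by (intro mult_right_mono) auto
  then have "\<alpha> * real k \<le> real m" using km by linarith
  \<comment> \<open>This makes the iterated logarithm nonnegative; with \<kappa>/\<delta> > 1 the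
    argument of \<open>h_inv\<close> is then positive.\<close>
  then have x1: "1 \<le> real m / (\<alpha> * real k)" using \<alpha> k by simp
  have "ln (pi\<^sup>2 / 6 / \<delta>) > 0"
    using pi_squared_div_6_gt_1 \<delta> by (intro ln_gt_zero) (simp add: field_simps)
  then have Lpos: "L (real m / (\<alpha> * real k)) > 0"
    using x1 by (simp add: L_def add_pos_nonneg)
  have "\<alpha> * 1 \<le> \<alpha> * real k" using \<alpha> k by (intro mult_left_mono) auto
  then have "real m / (\<alpha> * real k) \<le> real m / \<alpha>"
    using \<alpha> k by (intro divide_left_mono) auto
  then have L_mono: "L (real m / (\<alpha> * real k)) \<le> L (real m / \<alpha>)"
    using x1 by (auto simp: L_def intro!: ln_mono add_pos_nonneg)
  have "\<epsilon> \<le> \<alpha> * h_inv (L (real m / (\<alpha> * real k)) / (\<alpha> * real k)) - \<alpha>"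
    using ge k by (simp add: FDP_Well_def Let_def L_def k_def max_def split: if_splits)
  then have "1 + \<epsilon> / \<alpha> \<le> h_inv (L (real m / (\<alpha> * real k)) / (\<alpha> * real k))"
    using \<alpha> by (simp add: field_simps)
  then have "h (1 + \<epsilon> / \<alpha>) \<le> L (real m / (\<alpha> * real k)) / (\<alpha> * real k)"
    using Lpos \<alpha> \<epsilon> k by (intro h_le_if_le_h_inv) auto
  also have "\<dots> \<le> L (real m / \<alpha>) / (\<alpha> * real k)"
    using L_mono \<alpha> by (intro divide_right_mono) auto
  finally show "\<alpha> * h (1 + \<epsilon> / \<alpha>) \<le>
      (2 * ln (pi\<^sup>2 / 6 / \<delta>) + 4 * ln (1 + log 2 (real m / \<alpha>))) / real (khat \<alpha> m q)"
    using \<alpha> k by (simp add: L_def k_def field_simps)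
qed

text \<open>The iterated logarithm on the left is \<open>ln (ln m)\<close> up to a bounded term, so
  raising the factor from 4 to 5 absorbs all constants.\<close>

lemma eventually_ln_log_le_ln_ln:
  fixes c \<alpha> :: real
  assumes "\<alpha> > 0"
  shows "\<forall>\<^sub>F m in sequentially.
    c + 4 * ln (1 + log 2 (real m / \<alpha>)) \<le> 5 * ln (ln (real m))"
  using assms unfolding log_def by real_asymp

theorem proposition10:
  fixes \<alpha> \<delta> :: real
    and M :: "nat \<Rightarrow> 'a measure"
    and p :: "nat \<Rightarrow> nat \<Rightarrow> 'a \<Rightarrow> real"
    and H0 :: "nat \<Rightarrow> nat set"
  assumes "\<alpha> \<in> {0<..<1}" and "\<delta> \<in> {0<..<1}"
    and "\<And>m. m \<ge> 1 \<Longrightarrow> topk_model (M m) m (p m) (H0 m)"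
  shows "(oP1 M (\<lambda>m \<omega>. ereal (sqrt (real m)) / ereal (real (khat \<alpha> m (\<lambda>i. p m i \<omega>))))
            \<longrightarrow> BH_m_consistent M \<alpha> (\<lambda>m \<omega>. FDP_DKW \<alpha> \<delta> m (\<lambda>i. p m i \<omega>)))
       \<and> (oP1 M (\<lambda>m \<omega>. ereal (ln (ln (real m))) / ereal (real (khat \<alpha> m (\<lambda>i. p m i \<omega>))))
            \<longrightarrow> BH_m_consistent M \<alpha> (\<lambda>m \<omega>. FDP_Well \<alpha> \<delta> m (\<lambda>i. p m i \<omega>)))"
proof (intro conjI impI)
  have \<alpha>: "0 < \<alpha>" "\<alpha> < 1" and \<delta>: "0 < \<delta>" "\<delta> < 1" using assms by auto
  \<comment> \<open>For \<open>k\<close> at least 1 the extended quotient is the real one, and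
    taking the absolute value can only increase it.\<close>
  have ratio: "\<bar>ereal a / ereal (real k)\<bar> \<ge> ereal e" if "k \<ge> 1" "e \<le> a / real k"
    for a e and k :: nat
    using that order_trans[OF that(2) divide_right_mono[OF abs_ge_self[of a]]] by auto
  {
    assume oP: "oP1 M (\<lambda>m \<omega>. ereal (sqrt (real m)) / ereal (real (khat \<alpha> m (\<lambda>i. p m i \<omega>))))"
    show "BH_m_consistent M \<alpha> (\<lambda>m \<omega>. FDP_DKW \<alpha> \<delta> m (\<lambda>i. p m i \<omega>))"
    proof (rule BH_m_consistent_if_oP1_bound[OF assms(3) oP])
      fix \<epsilon> :: real assume \<epsilon>: "\<epsilon> > 0"
      show "\<exists>\<epsilon>'>0. \<forall>\<^sub>F m in sequentially. \<forall>q. FDP_DKW \<alpha> \<delta> m q - \<alpha> \<ge> \<epsilon> \<longrightarrow>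
          \<bar>ereal (sqrt (real m)) / ereal (real (khat \<alpha> m q))\<bar> \<ge> ereal \<epsilon>'"
      proof (intro exI[of _ "\<epsilon> / sqrt (0.5 * ln (1 / \<delta>))"] conjI always_eventually allI impI)
        show "0 < \<epsilon> / sqrt (0.5 * ln (1 / \<delta>))" using \<epsilon> \<delta> by simp
      next
        fix m q assume "FDP_DKW \<alpha> \<delta> m q - \<alpha> \<ge> \<epsilon>"
        with \<alpha> \<delta> \<epsilon> show "\<bar>ereal (sqrt (real m)) / ereal (real (khat \<alpha> m q))\<bar>
            \<ge> ereal (\<epsilon> / sqrt (0.5 * ln (1 / \<delta>)))"
          by (intro ratio FDP_DKW_excess_imp) auto
      qed
    qed
  next
    assume oP: "oP1 M (\<lambda>m \<omega>. ereal (ln (ln (real m))) / ereal (real (khat \<alpha> m (\<lambda>i. p m i \<omega>))))"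
    show "BH_m_consistent M \<alpha> (\<lambda>m \<omega>. FDP_Well \<alpha> \<delta> m (\<lambda>i. p m i \<omega>))"
    proof (rule BH_m_consistent_if_oP1_bound[OF assms(3) oP])
      fix \<epsilon> :: real assume \<epsilon>: "\<epsilon> > 0"
      \<comment> \<open>The divisor 5 is the factor in front of \<open>ln (ln m)\<close> in
        \<open>eventually_ln_log_le_ln_ln\<close>.\<close>
      define \<epsilon>' where "\<epsilon>' = \<alpha> * h (1 + \<epsilon> / \<alpha>) / 5"
      have "h (1 + \<epsilon> / \<alpha>) > 0"
        using bij_betw_apply[OF h_bij_betw, of "1 + \<epsilon> / \<alpha>"] \<epsilon> \<alpha> by simp
      then have "\<epsilon>' > 0" using \<alpha> by (simp add: \<epsilon>'_def)
      moreover have "\<forall>\<^sub>F m in sequentially. \<forall>q. FDP_Well \<alpha> \<delta> m q - \<alpha> \<ge> \<epsilon> \<longrightarrow>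
          \<bar>ereal (ln (ln (real m))) / ereal (real (khat \<alpha> m q))\<bar> \<ge> ereal \<epsilon>'"
        using eventually_ln_log_le_ln_ln[OF \<alpha>(1), of "2 * ln (pi\<^sup>2 / 6 / \<delta>)"]
      proof (eventually_elim, intro allI impI)
        fix m q
        assume le: "2 * ln (pi\<^sup>2 / 6 / \<delta>) + 4 * ln (1 + log 2 (real m / \<alpha>)) \<le> 5 * ln (ln (real m))"
          and ge: "FDP_Well \<alpha> \<delta> m q - \<alpha> \<ge> \<epsilon>"
        note excess = FDP_Well_excess_imp[OF \<alpha> \<delta> \<epsilon> ge]
        have "5 * \<epsilon>' \<le> 5 * ln (ln (real m)) / real (khat \<alpha> m q)"
          using order_trans[OF excess(2) divide_right_mono[OF le]] by (simp add: \<epsilon>'_def)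
        then have "\<epsilon>' \<le> ln (ln (real m)) / real (khat \<alpha> m q)" by simp
        with excess(1) show "\<bar>ereal (ln (ln (real m))) / ereal (real (khat \<alpha> m q))\<bar> \<ge> ereal \<epsilon>'"
          by (rule ratio)
      qed
      ultimately show "\<exists>\<epsilon>'>0. \<forall>\<^sub>F m in sequentially. \<forall>q. FDP_Well \<alpha> \<delta> m q - \<alpha> \<ge> \<epsilon> \<longrightarrow>
          \<bar>ereal (ln (ln (real m))) / ereal (real (khat \<alpha> m q))\<bar> \<ge> ereal \<epsilon>'"
        by blast
    qed
  }
qed

end
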